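(* Let $A\in\mathbb{R}^{m\times n}$, let $Q\in\mathbb{R}^{n\times n}$ be symmetric positive semidefinite, and at a fixed iteration $k$ let $\Theta_k$ be a diagonal matrix with positive diagonal entries, and let $\rho_k,\delta_k,\mu_k,C_{E,k}>0$. Let $\tilde M_{NE,k}$ and $P_{NE,k}$ be the $m\times m$ matrices defined in the context from these data. Let $r$ be the column rank of $A^T$. Then, among the $m$ eigenvalues of $P_{NE,k}^{-1}\tilde M_{NE,k}$ (counted with multiplicity), there are $m-r$ eigenvalues equal to one, corresponding to linearly independent eigenvectors belonging to the nullspace of $A^T$, and the remaining eigenvalues $\lambda$ satisfy \[1\le\lambda\le 1+\frac{C_{E,k}\,\mu_k}{\delta_k}\,\sigma_{\max}^2(A),\] where $\sigma_{\max}(A)$ denotes the largest singular value of $A$.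
   Context: Let $\tilde Q=\mathrm{diag}(Q)$ be the diagonal matrix with the same diagonal entries as $Q$. Define the diagonal matrix $\tilde G_k=(\tilde Q+\Theta_k^{-1}+\rho_k I_n)^{-1}$ and \[\tilde M_{NE,k}=A\tilde G_kA^T+\delta_k I_m .\] Define the diagonal matrix $E_k\in\mathbb{R}^{n\times n}$ by \[E_k^{(i,i)}=\begin{cases}0 & \text{if } \big((\Theta_k^{(i,i)})^{-1}+\tilde Q^{(i,i)}+\rho_k\big)^{-1}<C_{E,k}\min\{\mu_k,1\},\\ \big((\Theta_k^{(i,i)})^{-1}+\tilde Q^{(i,i)}+\rho_k\big)^{-1} & \text{otherwise,}\end{cases}\qquad i=1,\dots,n,\] where $M^{(i,i)}$ denotes the $i$-th diagonal entry of $M$, and set \[P_{NE,k}=AE_kA^T+\delta_k I_m .\] (In the source, $k$ is an iteration index of an interior point method for $\min_x c^Tx+\frac12x^TQx$ s.t. $Ax=b$, $x\ge0$; $\mu_k$ is the barrier parameter, $\rho_k,\delta_k$ are regularization parameters, and $\Theta_k=X_kZ_k^{-1}$, where $X_k,Z_k$ are diagonal matrices with positive diagonals.) *)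

theory Defs
  imports "Jordan_Normal_Form.DL_Rank" "Jordan_Normal_Form.Char_Poly"
    "Jordan_Normal_Form.Gauss_Jordan_Elimination"
begin

text \<open>Meaningful for invertible matrices only, where \<^const>\<open>mat_inverse\<close> is not \<^const>\<open>None\<close>.\<close>
definition mat_inv :: "'a :: field mat \<Rightarrow> 'a mat" where
  "mat_inv B = the (mat_inverse B)"

definition sym_psd_mat :: "nat \<Rightarrow> real mat \<Rightarrow> bool" where
  "sym_psd_mat n Q \<longleftrightarrow> Q \<in> carrier_mat n n \<and> transpose_mat Q = Q \<and>
     (\<forall>x \<in> carrier_vec n. 0 \<le> x \<bullet> (Q *\<^sub>v x))"

text \<open>A real matrix may have non-real eigenvalues, so the roots are taken over the complex
  numbers; for an m x m matrix the multiset then has exactly m elements.\<close>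
definition eigenvalue_mset :: "real mat \<Rightarrow> complex multiset" where
  "eigenvalue_mset B = proots (char_poly (map_mat complex_of_real B))"

text \<open>Unspecified if \<^term>\<open>A\<close> has no columns.\<close>
definition sigma_max :: "real mat \<Rightarrow> real" where
  "sigma_max A = Max {sqrt l |l. eigenvalue (transpose_mat A * A) l}"

definition diag_part :: "nat \<Rightarrow> real mat \<Rightarrow> real mat" where
  "diag_part n Q = mat_diag n (\<lambda>i. Q $$ (i,i))"

definition G_tilde :: "nat \<Rightarrow> real mat \<Rightarrow> real mat \<Rightarrow> real \<Rightarrow> real mat" where
  "G_tilde n Q \<Theta> \<rho> = mat_inv (diag_part n Q + mat_inv \<Theta> + \<rho> \<cdot>\<^sub>m 1\<^sub>m n)"

definition M_NE ::
  "nat \<Rightarrow> nat \<Rightarrow> real mat \<Rightarrow> real mat \<Rightarrow> real mat \<Rightarrow> real \<Rightarrow> real \<Rightarrow> real mat" where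
  "M_NE m n A Q \<Theta> \<rho> \<delta> = A * G_tilde n Q \<Theta> \<rho> * transpose_mat A + \<delta> \<cdot>\<^sub>m 1\<^sub>m m"

definition E_mat :: "nat \<Rightarrow> real mat \<Rightarrow> real mat \<Rightarrow> real \<Rightarrow> real \<Rightarrow> real \<Rightarrow> real mat" where
  "E_mat n Q \<Theta> \<rho> \<mu> C = mat_diag n (\<lambda>i.
     let g = inverse (inverse (\<Theta> $$ (i,i)) + diag_part n Q $$ (i,i) + \<rho>)
     in if g < C * min \<mu> 1 then 0 else g)"

definition P_NE ::
  "nat \<Rightarrow> nat \<Rightarrow> real mat \<Rightarrow> real mat \<Rightarrow> real mat \<Rightarrow> real \<Rightarrow> real \<Rightarrow> real \<Rightarrow> real \<Rightarrow> real mat" where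
  "P_NE m n A Q \<Theta> \<rho> \<delta> \<mu> C = A * E_mat n Q \<Theta> \<rho> \<mu> C * transpose_mat A + \<delta> \<cdot>\<^sub>m 1\<^sub>m m"

end

theory Submission
  imports Defs "Jordan_Normal_Form.Matrix_Kernel"
begin

text \<open>Both matrices have the form \<open>A D A\<^sup>T + \<delta> I\<close> with \<open>D\<close> diagonal and nonnegative: \<open>M\<close> has weights
\<open>g\<close>, and \<open>P\<close> has weights \<open>e\<close> that arise from \<open>g\<close> by dropping the entries below \<open>C min(\<mu>, 1)\<close>.
Hence \<open>0 \<le> g - e \<le> C \<mu>\<close> entrywise, and everything follows by comparing quadratic forms.

For the bounds, \<open>P\<close> is positive definite with \<open>x \<bullet> P x \<ge> \<delta> (x \<bullet> x)\<close>, and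
\<open>x \<bullet> P x \<le> x \<bullet> M x \<le> x \<bullet> P x + C \<mu> (A\<^sup>T x) \<bullet> (A\<^sup>T x)\<close>. With
\<open>(A\<^sup>T x) \<bullet> (A\<^sup>T x) \<le> \<sigma>\<^sup>2 (x \<bullet> x)\<close>, where \<open>\<sigma>\<close> is the largest singular value, the generalized
Rayleigh quotient of the pencil \<open>(M, P)\<close> lies in \<open>[1, 1 + C \<mu> \<sigma>\<^sup>2 / \<delta>]\<close>, and so do all complex
eigenvalues of \<open>P\<^sup>-\<^sup>1 M\<close> (lemma \<open>pencil_eigenvalue_real_bounded\<close>). That the largest eigenvalue of the
Gram matrix \<open>A\<^sup>T A\<close> dominates its Rayleigh quotient is \<open>symmetric_max_eigenvalue\<close>.

For the multiplicities, \<open>M\<close> and \<open>P\<close> both act as \<open>\<delta> I\<close> on the nullspace of \<open>A\<^sup>T\<close>, so each of its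
nonzero elements is an eigenvector of \<open>P\<^sup>-\<^sup>1 M\<close> for the eigenvalue 1. By rank-nullity this space has
dimension \<open>m - r\<close> (lemma \<open>dim_mat_kernel\<close>), and a geometric multiplicity is at most the algebraic one
(lemma \<open>eigenvectors_power_dvd_char_poly\<close>). So \<open>(X - 1)\<^sup>m\<^sup>-\<^sup>r\<close> divides the characteristic polynomial,
and the roots of the cofactor are the other \<open>r\<close> eigenvalues; each of them satisfies the bounds because
every eigenvalue does.\<close>

section \<open>Matrix inverses\<close>

lemma det_nonzero_mat_inv:
  fixes B :: "'a :: field mat"
  assumes B: "B \<in> carrier_mat n n" and det: "det B \<noteq> 0"
  shows "mat_inv B \<in> carrier_mat n n" "B * mat_inv B = 1\<^sub>m n" "mat_inv B * B = 1\<^sub>m n" "invertible_mat B"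
proof -
  obtain X where X: "mat_inverse B = Some X"
    using mat_inverse(1)[OF B, of "()"] det_non_zero_imp_unit[OF B det, of "()"]
    by (cases "mat_inverse B") simp_all
  note X' = mat_inverse(2)[OF B X]
  show 1: "mat_inv B \<in> carrier_mat n n" "B * mat_inv B = 1\<^sub>m n" "mat_inv B * B = 1\<^sub>m n"
    using X' by (simp_all add: mat_inv_def X)
  show "invertible_mat B"
    unfolding invertible_mat_def inverts_mat_def square_mat.simps carrier_matD[OF B]
    by (intro conjI refl exI[of _ "mat_inv B"]) (simp_all only: 1 carrier_matD[OF 1(1)])
qed

lemma mat_inv_eqI:
  fixes B :: "'a :: field mat"
  assumes B: "B \<in> carrier_mat n n" and C: "C \<in> carrier_mat n n" and BC: "B * C = 1\<^sub>m n"
  shows "mat_inv B = C"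
proof -
  have CB: "C * B = 1\<^sub>m n" using mat_mult_left_right_inverse[OF B C BC] .
  have "B \<in> Units (ring_mat TYPE('a) n ())"
    using B C BC CB by (auto simp: Units_def ring_mat_def)
  then obtain X where X: "mat_inverse B = Some X" using mat_inverse(1)[OF B, of "()"] by blast
  note X' = mat_inverse(2)[OF B X]
  have "X = X * (B * C)" using BC X' by (simp add: right_mult_one_mat[of _ n n])
  also have "\<dots> = C" using X' B C by (simp add: assoc_mult_mat[symmetric, of _ n n _ n _ n])
  finally show ?thesis unfolding mat_inv_def X by simp
qed

lemma mat_inv_mat_diag:
  fixes f :: "nat \<Rightarrow> 'a :: field"
  assumes "\<And>i. i < n \<Longrightarrow> f i \<noteq> 0"
  shows "mat_inv (mat_diag n f) = mat_diag n (\<lambda>i. inverse (f i))"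
proof (rule mat_inv_eqI)
  show "mat_diag n f * mat_diag n (\<lambda>i. inverse (f i)) = 1\<^sub>m n"
    unfolding mat_diag_diag by (rule eq_matI) (auto simp: mat_diag_def assms)
qed auto

section \<open>Dimension of the nullspace and multiplicity of eigenvalues\<close>

lemma mult_mat_vec_linear_map:
  fixes B :: "'a :: field mat"
  assumes B: "B \<in> carrier_mat nr nc"
  shows "linear_map class_ring (module_vec TYPE('a) nc) (module_vec TYPE('a) nr) (\<lambda>v. B *\<^sub>v v)"
proof -
  have "(\<lambda>v. B *\<^sub>v v) \<in> LinearCombinations.module_hom class_ring (module_vec TYPE('a) nc) (module_vec TYPE('a) nr)"
    using B by (auto simp: LinearCombinations.module_hom_def module_vec_simps mult_add_distrib_mat_vec[OF B] mult_mat_vec[OF B])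
  then show ?thesis
    unfolding linear_map_def mod_hom_def mod_hom_axioms_def
    using vec_vs vec_module by auto
qed

lemma mult_mat_vec_ker:
  fixes B :: "'a :: field mat"
  assumes B: "B \<in> carrier_mat nr nc"
  shows "mod_hom.ker (module_vec TYPE('a) nc) (module_vec TYPE('a) nr) (\<lambda>v. B *\<^sub>v v) = mat_kernel B"
  unfolding mod_hom.ker_def[OF linear_map.axioms(3)[OF mult_mat_vec_linear_map[OF B]]] mat_kernel[OF B]
  by (simp only: module_vec_simps)

lemma mult_mat_vec_im:
  fixes B :: "'a :: field mat"
  assumes B: "B \<in> carrier_mat nr nc"
  shows "mod_hom.im (module_vec TYPE('a) nc) (\<lambda>v. B *\<^sub>v v)
    = LinearCombinations.module.span class_ring (module_vec TYPE('a) nr) (set (cols B))"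
proof -
  interpret W: vec_space "TYPE('a)" nr .
  show ?thesis
    using W.col_space_eq[OF B] B
    unfolding mod_hom.im_def[OF linear_map.axioms(3)[OF mult_mat_vec_linear_map[OF B]]] W.col_space_def
    by (auto simp: module_vec_simps)
qed

lemma dim_mat_kernel:
  fixes B :: "'a :: field mat"
  assumes B: "B \<in> carrier_mat nr nc"
  shows "kernel.dim nc B = nc - vec_space.rank nr B"
proof -
  have "vec_space.rank nr B + kernel.dim nc B = vectorspace.dim class_ring (module_vec TYPE('a) nc)"
    using linear_map.rank_nullity[OF mult_mat_vec_linear_map[OF B] vec_space.fin_dim]
    unfolding mult_mat_vec_im[OF B] mult_mat_vec_ker[OF B] vec_space.rank_def .
  then show ?thesis unfolding vec_space.dim_is_n by linarith
qed

text \<open>Any basis of the nullspace will do. Its independence, known in the nullspace as a vector space of its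
own, carries over to the ambient space because linear combinations in both are the same.\<close>

lemma mat_kernel_indpt_set:
  fixes B :: "'a :: field mat"
  assumes B: "B \<in> carrier_mat nr nc"
  obtains V where "V \<subseteq> mat_kernel B" "finite V" "card V = nc - vec_space.rank nr B"
    "module.lin_indpt class_ring (module_vec TYPE('a) nc) V"
proof -
  interpret K: kernel nr nc B by unfold_locales (rule B)
  obtain V where V: "finite V" "K.basis V"
    using kernel_basis_exists[OF B] by blast
  then have sub: "V \<subseteq> mat_kernel B" and li: "K.lin_indpt V"
    unfolding K.Ker.basis_def by auto
  have "submodule class_ring (mat_kernel B) K.NC.V"
    using mod_hom.ker_is_submodule[OF linear_map.axioms(3)[OF mult_mat_vec_linear_map[OF B]]]
    unfolding mult_mat_vec_ker[OF B] .
  then have "K.NC.lin_indpt V"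
    using K.NC.span_li_not_depend(2)[OF sub] li by simp
  moreover have "card V = nc - vec_space.rank nr B"
    using K.Ker.dim_basis[OF V] dim_mat_kernel[OF B] by simp
  ultimately show thesis by (intro that[OF sub V(1)])
qed

text \<open>The geometric multiplicity is at most the algebraic one. Complete \<open>V\<close> to a basis and let \<open>S\<close> be the
invertible matrix with these basis vectors as columns, those from \<open>V\<close> first. A column \<open>v \<in> V\<close> of \<open>S\<close>
becomes the column \<open>(X - a) v\<close> of \<open>(X I - N) S\<close>, so the factor \<open>X - a\<close> can be pulled out of \<open>card V\<close>
columns of this matrix, whose determinant is \<open>char_poly N\<close> times the nonzero constant \<open>det S\<close>.\<close>

lemma eigenvectors_power_dvd_char_poly:
  fixes N :: "'a :: field mat"
  assumes N: "N \<in> carrier_mat n n" and V: "V \<subseteq> carrier_vec n"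
    and indpt: "module.lin_indpt class_ring (module_vec TYPE('a) n) V"
    and eig: "\<And>v. v \<in> V \<Longrightarrow> N *\<^sub>v v = a \<cdot>\<^sub>v v"
  shows "[:-a, 1:] ^ card V dvd char_poly N"
proof -
  interpret W: vec_space "TYPE('a)" n .
  have fin: "finite V" using W.li_le_dim(1)[OF W.fin_dim] V indpt by simp
  have "V \<subseteq> W.span (set (unit_vecs n))"
    using V W.span_unit_vecs_is_carrier by simp
  then obtain U where U: "finite U" "U \<subseteq> carrier_vec n" "U \<inter> V = {}"
      "int (card U) \<le> int (card (set (unit_vecs n :: 'a vec list))) - int (card V)"
      "W.span (V \<union> U) = carrier_vec n"
    using W.replacement[OF fin finite_set _ indpt, of "unit_vecs n"] W.span_unit_vecs_is_carrier
    using unit_vecs_carrier[of n] by auto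
  have cn: "card (set (unit_vecs n :: 'a vec list)) = n"
    by (metis W.unit_vecs_distinct W.unit_vecs_length distinct_card)
  obtain vs us where vs: "set vs = V" "distinct vs" and us: "set us = U" "distinct us"
    using fin U(1) finite_distinct_list by metis
  have lvs: "length vs = card V" using vs distinct_card by metis
  define bs where "bs = vs @ us"
  have dist: "distinct bs" and setbs: "set bs = V \<union> U"
    using vs us U(3) by (auto simp: bs_def)
  have cle: "card (V \<union> U) \<le> n"
    using U(4) cn card_Un_le[of V U] by linarith
  have car: "V \<union> U \<subseteq> carrier_vec n" using V U by auto
  have "W.gen_set (V \<union> U)" using U(5) by simp
  then have ge: "n \<le> card (V \<union> U)"
    using W.gen_ge_dim[of "V \<union> U"] fin U(1) car W.dim_is_n by simp
  then have bas: "W.basis (V \<union> U)"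
    using W.dim_gen_is_basis[of "V \<union> U"] fin U(1,5) car W.dim_is_n cle by simp
  have lbs: "length bs = n"
    using ge cle dist setbs distinct_card by force
  define S where "S = mat_of_cols n bs"
  have S: "S \<in> carrier_mat n n" unfolding S_def using lbs by auto
  have cols: "cols S = bs"
    unfolding S_def by (rule cols_mat_of_cols) (use car setbs in auto)
  have "W.rank S = n"
    using W.lin_indpt_full_rank[OF S] cols dist setbs bas by (auto simp: W.basis_def)
  then have detS: "det S \<noteq> 0" using W.det_rank_iff[OF S] by simp
  let ?h = "map_mat (\<lambda>c::'a. [:c:])"
  define k where "k = card V"
  define X where "X = char_poly_matrix N * ?h S"
  define D where "D = mat n n (\<lambda>(i,j). if i = j then (if j < k then [:-a,1:] else 1) else 0)"
  \<comment> \<open>\<^term>\<open>S'\<close> is \<^term>\<open>X\<close> with the factor \<^term>\<open>[:-a, 1:]\<close> removed from its first \<^term>\<open>k\<close> columns.\<close>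
  define S' where "S' = mat n n (\<lambda>(i,j). if j < k then [:S $$ (i,j):] else X $$ (i,j))"
  have kn: "k \<le> n" using lbs lvs by (simp add: bs_def k_def)
  have Xc: "X \<in> carrier_mat n n"
    unfolding X_def by (intro mult_carrier_mat[of _ n n]) (use N S in auto)
  have fac: "X = S' * D"
  proof (rule eq_matI)
    fix i j assume "i < dim_row (S' * D)" "j < dim_col (S' * D)"
    then have i: "i < n" and j: "j < n" by (auto simp: S'_def D_def)
    have "(S' * D) $$ (i,j) = (\<Sum>l<n. S' $$ (i,l) * D $$ (l,j))"
      using i j by (simp add: S'_def D_def scalar_prod_def atLeast0LessThan)
    also have "\<dots> = (\<Sum>l<n. if l = j then S' $$ (i,j) * D $$ (j,j) else 0)"
      using i j by (intro sum.cong) (auto simp: D_def)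
    also have "\<dots> = S' $$ (i,j) * D $$ (j,j)" using j by simp
    finally have r: "(S' * D) $$ (i,j) = S' $$ (i,j) * D $$ (j,j)" .
    show "X $$ (i,j) = (S' * D) $$ (i,j)"
    proof (cases "j < k")
      case False
      then show ?thesis unfolding r using i j by (simp add: S'_def D_def)
    next
      case True
      have colj: "col S j = vs ! j" "vs ! j \<in> V"
        using True lvs j S cols_nth[of j S] nth_mem[of j vs] unfolding cols vs(1) bs_def k_def
        by (simp_all add: nth_append)
      have "N *\<^sub>v col S j = a \<cdot>\<^sub>v col S j"
        unfolding colj(1) by (rule eig[OF colj(2)])
      then have "(N *\<^sub>v col S j) $ i = a * S $$ (i,j)"
        using i j S by simp
      then have NS: "(\<Sum>l<n. N $$ (i,l) * S $$ (l,j)) = a * S $$ (i,j)"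
        using i j S N by (simp add: scalar_prod_def atLeast0LessThan)
      have "X $$ (i,j) = (\<Sum>l<n. char_poly_matrix N $$ (i,l) * [:S $$ (l,j):])"
        using i j S N carrier_matD[OF char_poly_matrix_closed[OF N]] by (simp add: X_def scalar_prod_def atLeast0LessThan)
      also have "\<dots> = (\<Sum>l<n. (if l = i then [:0, S $$ (i,j):] else 0) - [:N $$ (i,l) * S $$ (l,j):])"
        using i j S N by (intro sum.cong) (auto simp: char_poly_matrix_def)
      also have "\<dots> = [:0, S $$ (i,j):] - [:\<Sum>l<n. N $$ (i,l) * S $$ (l,j):]"
      proof -
        have "(\<Sum>l<n. [:N $$ (i,l) * S $$ (l,j):]) = [:\<Sum>l<n. N $$ (i,l) * S $$ (l,j):]"
          by (induction n) simp_all
        then show ?thesis using i by (simp only: sum_subtractf) simp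
      qed
      also have "\<dots> = [:S $$ (i,j):] * [:-a,1:]" unfolding NS by simp
      finally show ?thesis unfolding r using i j True by (simp add: S'_def D_def)
    qed
  qed (use Xc in \<open>auto simp: S'_def D_def\<close>)
  have "det D = prod_list (diag_mat D)"
    by (rule det_upper_triangular[of _ n]) (auto simp: D_def)
  also have "\<dots> = (\<Prod>j<n. if j < k then [:-a,1:] else 1)"
    by (simp add: prod_list_diag_prod D_def atLeast0LessThan)
  also have "\<dots> = (\<Prod>j<k. [:-a,1:])"
    using kn by (intro prod.mono_neutral_cong_right) auto
  finally have detD: "det D = [:-a,1:] ^ k" by simp
  interpret C: comm_ring_hom "\<lambda>c::'a. [:c:]"
    by unfold_locales (auto simp: one_pCons)
  have "det (?h S) = [:det S:]" by (rule C.hom_det)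
  moreover have "det X = char_poly N * det (?h S)"
    unfolding X_def char_poly_def by (rule det_mult[of _ n]) (use N S in auto)
  moreover have "det X = det S' * [:-a,1:] ^ k"
    unfolding detD[symmetric] by (subst fac, rule det_mult[of _ n]) (auto simp: S'_def D_def)
  ultimately have "char_poly N * [:det S:] = det S' * [:-a,1:] ^ k" by metis
  then have "[:-a,1:] ^ k dvd char_poly N * [:det S:]" by simp
  moreover have "is_unit [:det S:]" using detS by (simp add: is_unit_pCons_iff)
  ultimately show ?thesis unfolding k_def by (simp only: dvd_mult_unit_iff)
qed

text \<open>For \<open>k\<close> up to the multiplicity of 1, splitting off that many copies leaves the roots of the cofactor
of \<open>(X - 1)\<^sup>k\<close>. Those are again eigenvalues, and a polynomial over the complex numbers has as many
roots as its degree, which gives their number.\<close>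

lemma eigenvalue_mset_split:
  fixes N :: "real mat"
  assumes N: "N \<in> carrier_mat m m" and dvd: "[:-1, 1:] ^ k dvd char_poly N"
    and bounds: "\<And>l. eigenvalue (map_mat complex_of_real N) l \<Longrightarrow>
      l = complex_of_real (Re l) \<and> a \<le> Re l \<and> Re l \<le> b"
  obtains L :: "real multiset" where
    "eigenvalue_mset N = replicate_mset k 1 + image_mset complex_of_real L"
    "size L = m - k" "\<And>l. l \<in># L \<Longrightarrow> a \<le> l \<and> l \<le> b"
proof -
  interpret h: map_poly_comm_ring_hom complex_of_real ..
  let ?N = "map_mat complex_of_real N"
  have CN: "?N \<in> carrier_mat m m" using N by simp
  obtain q0 where q0: "char_poly N = [:-1, 1:] ^ k * q0" using dvd by (elim dvdE)
  define q where "q = map_poly complex_of_real q0"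
  have cp: "char_poly ?N = [:-1, 1:] ^ k * q"
    unfolding of_real_hom.char_poly_hom[OF N] q0 h.hom_mult h.hom_power q_def by simp
  have deg: "degree (char_poly ?N) = m" and nz: "char_poly ?N \<noteq> 0"
    using degree_monic_char_poly[OF CN] by auto
  then have q: "q \<noteq> 0" using cp by auto
  have "proots (char_poly ?N) = proots ([:-1, 1:] ^ k) + proots q"
    unfolding cp by (rule proots_mult) (use q in auto)
  also have "proots ([:-1, 1:] ^ k :: complex poly) = replicate_mset k 1"
    by (simp add: proots_power)
  finally have split: "eigenvalue_mset N = replicate_mset k 1 + proots q"
    by (simp add: eigenvalue_mset_def)
  have root: "eigenvalue ?N l" if "l \<in># proots q" for l
  proof -
    have "poly q l = 0" using that unfolding set_count_proots[OF q] by (rule CollectD)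
    then show ?thesis unfolding eigenvalue_root_char_poly[OF CN] cp poly_mult by (simp only: mult_zero_right)
  qed
  have real: "complex_of_real (Re l) = l" if "l \<in># proots q" for l
    by (rule sym[OF conjunct1[OF bounds[OF root[OF that]]]])
  have "image_mset complex_of_real (image_mset Re (proots q)) = image_mset (\<lambda>l. l) (proots q)"
    unfolding image_mset.compositionality o_def by (rule image_mset_cong[OF real])
  then have "image_mset complex_of_real (image_mset Re (proots q)) = proots q" by simp
  moreover have "size (image_mset Re (proots q)) = m - k"
    using deg q unfolding cp by (simp add: size_proots_complex degree_mult_eq degree_power_eq)
  moreover have range: "a \<le> l \<and> l \<le> b" if "l \<in># image_mset Re (proots q)" for l
  proof -
    obtain z where "z \<in># proots q" "l = Re z" using \<open>l \<in># image_mset Re (proots q)\<close> by auto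
    then show ?thesis using conjunct2[OF bounds[OF root[of z]]] by (simp only:)
  qed
  ultimately show thesis unfolding split[symmetric] by (intro that[of "image_mset Re (proots q)"]) (simp_all add: split)
qed

section \<open>The largest eigenvalue of a symmetric matrix\<close>

lemma scalar_prod_self_as_sum:
  fixes x :: "real vec"
  assumes "x \<in> carrier_vec n"
  shows "x \<bullet> x = (\<Sum>i<n. (x $ i)\<^sup>2)"
  using assms by (simp add: scalar_prod_def atLeast0LessThan power2_eq_square)

lemma scalar_prod_self_nonneg:
  fixes x :: "real vec"
  assumes "x \<in> carrier_vec n"
  shows "0 \<le> x \<bullet> x"
  unfolding scalar_prod_self_as_sum[OF assms] by (simp add: sum_nonneg)

lemma scalar_prod_self_pos:
  fixes x :: "real vec"
  assumes x: "x \<in> carrier_vec n" and "x \<noteq> 0\<^sub>v n"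
  shows "x \<bullet> x > 0"
proof -
  obtain i where i: "i < n" "x $ i \<noteq> 0"
    using assms by (auto simp: vec_eq_iff)
  then have "(x $ i)\<^sup>2 \<le> (\<Sum>i<n. (x $ i)\<^sup>2)" by (intro member_le_sum) auto
  moreover have "0 < (x $ i)\<^sup>2" using i by simp
  ultimately show ?thesis unfolding scalar_prod_self_as_sum[OF x] by linarith
qed

lemma quadratic_form_bounded:
  fixes B :: "real mat"
  assumes B: "B \<in> carrier_mat n n"
  obtains K where "K > 0" "\<And>x. x \<in> carrier_vec n \<Longrightarrow> \<bar>x \<bullet> (B *\<^sub>v x)\<bar> \<le> K * (x \<bullet> x)"
proof
  let ?K = "1 + (\<Sum>i<n. \<Sum>j<n. \<bar>B $$ (i,j)\<bar>)"
  show "?K > 0" by (intro add_pos_nonneg sum_nonneg) auto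
  fix x :: "real vec" assume x: "x \<in> carrier_vec n"
  have prod: "\<bar>x $ i * x $ j\<bar> \<le> x \<bullet> x" if "i < n" "j < n" for i j
  proof -
    have le: "(x $ l)\<^sup>2 \<le> x \<bullet> x" if "l < n" for l
      unfolding scalar_prod_self_as_sum[OF x] using that by (intro member_le_sum) auto
    have "2 * \<bar>x $ i * x $ j\<bar> \<le> (x $ i)\<^sup>2 + (x $ j)\<^sup>2"
      using sum_squares_bound[of "\<bar>x $ i\<bar>" "\<bar>x $ j\<bar>"] by (simp add: abs_mult)
    then show ?thesis using le[OF that(1)] le[OF that(2)] by linarith
  qed
  have "x \<bullet> (B *\<^sub>v x) = (\<Sum>i<n. \<Sum>j<n. B $$ (i,j) * (x $ i * x $ j))"
    using x B by (simp add: scalar_prod_def atLeast0LessThan sum_distrib_left algebra_simps)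
  also have "\<bar>\<dots>\<bar> \<le> (\<Sum>i<n. \<Sum>j<n. \<bar>B $$ (i,j)\<bar> * \<bar>x $ i * x $ j\<bar>)"
    unfolding abs_mult[symmetric]
    by (intro order_trans[OF sum_abs] sum_mono) simp
  also have "\<dots> \<le> (\<Sum>i<n. \<Sum>j<n. \<bar>B $$ (i,j)\<bar> * (x \<bullet> x))"
    using prod by (intro sum_mono mult_left_mono) auto
  also have "\<dots> = (\<Sum>i<n. \<Sum>j<n. \<bar>B $$ (i,j)\<bar>) * (x \<bullet> x)"
    by (simp add: sum_distrib_right)
  also have "\<dots> \<le> ?K * (x \<bullet> x)"
    by (intro mult_right_mono) (auto simp: scalar_prod_self_as_sum[OF x] sum_nonneg)
  finally show "\<bar>x \<bullet> (B *\<^sub>v x)\<bar> \<le> ?K * (x \<bullet> x)" .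
qed

text \<open>The least upper bound \<open>t\<close> of the Rayleigh quotient is an eigenvalue. Otherwise \<open>S = t I - B\<close> is invertible
besides being positive semidefinite, and then it is bounded below by a positive multiple of the
identity, so that \<open>t\<close> could be lowered. The lower bound for \<open>S\<close> needs no compactness argument: with
\<open>S y = x\<close> and \<open>\<bar>x \<bullet> y\<bar> \<le> K (x \<bullet> x)\<close>, expanding \<open>0 \<le> (x - y / K) \<bullet> S (x - y / K)\<close> gives
\<open>x \<bullet> S x \<ge> (x \<bullet> x) / K\<close>.\<close>

lemma symmetric_max_eigenvalue:
  fixes B :: "real mat"
  assumes B: "B \<in> carrier_mat n n" and sym: "transpose_mat B = B" and n: "n > 0"
  obtains t where "eigenvalue B t" "\<And>x. x \<in> carrier_vec n \<Longrightarrow> x \<bullet> (B *\<^sub>v x) \<le> t * (x \<bullet> x)"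
proof -
  define T where "T = {t. \<forall>x \<in> carrier_vec n. x \<bullet> (B *\<^sub>v x) \<le> t * (x \<bullet> x)}"
  obtain K0 where "K0 > 0" "\<And>x. x \<in> carrier_vec n \<Longrightarrow> \<bar>x \<bullet> (B *\<^sub>v x)\<bar> \<le> K0 * (x \<bullet> x)"
    using quadratic_form_bounded[OF B] by blast
  then have "K0 \<in> T" unfolding T_def by fastforce
  have bdd: "bdd_below T"
  proof (rule bdd_belowI)
    fix t assume "t \<in> T"
    then have "unit_vec n 0 \<bullet> (B *\<^sub>v unit_vec n 0) \<le> t * (unit_vec n 0 \<bullet> unit_vec n 0)"
      by (auto simp: T_def)
    then show "unit_vec n 0 \<bullet> (B *\<^sub>v unit_vec n 0) \<le> t" using n by simp
  qed
  define t where "t = Inf T"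
  have t: "x \<bullet> (B *\<^sub>v x) \<le> t * (x \<bullet> x)" if x: "x \<in> carrier_vec n" for x
  proof (cases "x = 0\<^sub>v n")
    case True
    then show ?thesis using B by simp
  next
    case False
    note pos = scalar_prod_self_pos[OF x False]
    have "x \<bullet> (B *\<^sub>v x) / (x \<bullet> x) \<le> t" unfolding t_def
    proof (rule cInf_greatest)
      show "T \<noteq> {}" using \<open>K0 \<in> T\<close> by auto
      fix s assume "s \<in> T"
      then show "x \<bullet> (B *\<^sub>v x) / (x \<bullet> x) \<le> s" using x pos by (simp add: T_def divide_le_eq)
    qed
    then show ?thesis using pos by (simp add: divide_le_eq)
  qed
  have "eigenvalue B t"
  proof (rule ccontr)
    assume "\<not> eigenvalue B t"
    then have det: "det (char_matrix B t) \<noteq> 0" using eigenvalue_det[OF B] by simp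
    have cB: "char_matrix B t \<in> carrier_mat n n" using B by simp
    define R where "R = mat_inv (char_matrix B t)"
    have R: "R \<in> carrier_mat n n" "char_matrix B t * R = 1\<^sub>m n"
      using det_nonzero_mat_inv[OF cB det] by (simp_all add: R_def)
    obtain K where K: "K > 0" "\<And>x. x \<in> carrier_vec n \<Longrightarrow> \<bar>x \<bullet> (R *\<^sub>v x)\<bar> \<le> K * (x \<bullet> x)"
      using quadratic_form_bounded[OF R(1)] by blast
    have "t - 1 / K \<in> T" unfolding T_def
    proof (intro CollectI ballI)
      fix x :: "real vec" assume x: "x \<in> carrier_vec n"
      define y where "y = R *\<^sub>v x"
      have y: "y \<in> carrier_vec n" using R x by (simp add: y_def)
      have "char_matrix B t *\<^sub>v y = x"
        using R x cB by (simp add: y_def assoc_mult_mat_vec[symmetric])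
      moreover have "char_matrix B t *\<^sub>v y = B *\<^sub>v y - t \<cdot>\<^sub>v y"
        using B y unfolding char_matrix_def
        by (subst add_mult_distrib_mat_vec[of _ n n]) (auto intro!: eq_vecI)
      ultimately have By: "B *\<^sub>v y = x + t \<cdot>\<^sub>v y"
        using x y B by (auto simp: vec_eq_iff)
      \<comment> \<open>Here \<^term>\<open>R\<close> inverts \<open>B - t I\<close>, so \<open>- y\<close> is the solution for \<open>t I - B\<close>, hence the plus sign in \<open>z\<close>.\<close>
      define k where "k = 1 / K"
      define z where "z = x + k \<cdot>\<^sub>v y"
      have z: "z \<in> carrier_vec n" using x y by (simp add: z_def)
      have Bx: "B *\<^sub>v x \<in> carrier_vec n" using B x by simp
      have yx: "y \<bullet> x = x \<bullet> y" using x y by (rule comm_scalar_prod[rotated])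
      have yBx: "y \<bullet> (B *\<^sub>v x) = x \<bullet> x + t * (x \<bullet> y)"
      proof -
        have "y \<bullet> (B *\<^sub>v x) = (B *\<^sub>v y) \<bullet> x"
          using transpose_vec_mult_scalar[OF B x y] sym by simp
        also have "\<dots> = x \<bullet> x + t * (y \<bullet> x)" unfolding By using x y
          by (subst add_scalar_prod_distrib[of _ n]) auto
        finally show ?thesis unfolding yx .
      qed
      have "B *\<^sub>v z = B *\<^sub>v x + k \<cdot>\<^sub>v (B *\<^sub>v y)"
        unfolding z_def using x y B
        by (simp add: mult_add_distrib_mat_vec[of _ n n] mult_mat_vec[of _ n n])
      then have Bz: "B *\<^sub>v z = B *\<^sub>v x + k \<cdot>\<^sub>v (x + t \<cdot>\<^sub>v y)" unfolding By .
      have left: "z \<bullet> w = x \<bullet> w + k * (y \<bullet> w)" if "w \<in> carrier_vec n" for w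
        unfolding z_def using x y that by (subst add_scalar_prod_distrib[of _ n]) auto
      have right: "w \<bullet> (u + c \<cdot>\<^sub>v v) = w \<bullet> u + c * (w \<bullet> v)"
        if "w \<in> carrier_vec n" "u \<in> carrier_vec n" "v \<in> carrier_vec n" for w u v :: "real vec" and c
        using that by (subst scalar_prod_add_distrib[of _ n]) (auto simp: carrier_vecD)
      have zBz: "z \<bullet> (B *\<^sub>v z) = x \<bullet> (B *\<^sub>v x) + k * (x \<bullet> x + t * (x \<bullet> y))
          + k * (x \<bullet> x + t * (x \<bullet> y) + k * (x \<bullet> y + t * (y \<bullet> y)))"
        unfolding left[OF mult_mat_vec_carrier[OF B z]] unfolding Bz
        using x y Bx by (simp add: right yBx yx)
      have zz: "z \<bullet> z = x \<bullet> x + k * (x \<bullet> y) + k * (x \<bullet> y + k * (y \<bullet> y))"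
        unfolding left[OF z] unfolding z_def using x y by (simp add: right yx)
      have ineq: "x \<bullet> (B *\<^sub>v x) + 2 * k * (x \<bullet> x) + k * k * (x \<bullet> y) \<le> t * (x \<bullet> x)"
        using t[OF z] unfolding zBz zz by (simp add: algebra_simps)
      have "- (x \<bullet> y) \<le> K * (x \<bullet> x)" using K(2)[OF x] by (simp add: y_def)
      then have "k * k * (- (x \<bullet> y)) \<le> k * k * (K * (x \<bullet> x))"
        by (intro mult_left_mono) auto
      also have "\<dots> = k * (x \<bullet> x)" using K(1) by (simp add: k_def)
      finally show "x \<bullet> (B *\<^sub>v x) \<le> (t - 1/K) * (x \<bullet> x)"
        using ineq unfolding k_def[symmetric] by (simp add: algebra_simps)
    qed
    then have "t \<le> t - 1 / K" unfolding t_def using bdd by (intro cInf_lower)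
    then show False using K(1) by simp
  qed
  then show thesis using that t by blast
qed

text \<open>The eigenvalue \<open>t\<close> bounds \<open>(A x) \<bullet> (A x)\<close> directly, since this is the quadratic form of the Gram
matrix. To pass to the transpose, put \<open>u = A\<^sup>T v\<close>, so that \<open>u \<bullet> u = v \<bullet> A u\<close>, and expand the square
of \<open>t v - A u\<close>. This step divides by \<open>t\<close>, hence the separate case \<open>A u = 0\<close>.\<close>

lemma Gram_eigenvalue_bounds_transpose:
  fixes A :: "real mat"
  assumes A: "A \<in> carrier_mat m n" and n: "n > 0"
  obtains t where "eigenvalue (transpose_mat A * A) t"
    "\<And>v. v \<in> carrier_vec m \<Longrightarrow> (transpose_mat A *\<^sub>v v) \<bullet> (transpose_mat A *\<^sub>v v) \<le> t * (v \<bullet> v)"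
proof -
  let ?B = "transpose_mat A * A"
  have B: "?B \<in> carrier_mat n n" using A by simp
  have "transpose_mat ?B = ?B" using A by (simp add: transpose_mult[of _ n m])
  then obtain t where ev: "eigenvalue ?B t"
      and t: "\<And>x. x \<in> carrier_vec n \<Longrightarrow> x \<bullet> (?B *\<^sub>v x) \<le> t * (x \<bullet> x)"
    using symmetric_max_eigenvalue[OF B _ n] by blast
  have Ax: "(A *\<^sub>v x) \<bullet> (A *\<^sub>v x) \<le> t * (x \<bullet> x)" if x: "x \<in> carrier_vec n" for x
  proof -
    have "x \<bullet> (?B *\<^sub>v x) = x \<bullet> (transpose_mat A *\<^sub>v (A *\<^sub>v x))"
      using A x by (simp add: assoc_mult_mat_vec[of _ n m _ n])
    also have "\<dots> = (A *\<^sub>v x) \<bullet> (A *\<^sub>v x)"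
      using A x transpose_vec_mult_scalar[of "transpose_mat A" n m "A *\<^sub>v x" x] by simp
    finally show ?thesis using t[OF x] by simp
  qed
  have "(transpose_mat A *\<^sub>v v) \<bullet> (transpose_mat A *\<^sub>v v) \<le> t * (v \<bullet> v)"
    if v: "v \<in> carrier_vec m" for v
  proof -
    define u where "u = transpose_mat A *\<^sub>v v"
    define w where "w = A *\<^sub>v u"
    have u: "u \<in> carrier_vec n" and w: "w \<in> carrier_vec m" using A v by (auto simp: u_def w_def)
    have uu: "u \<bullet> u = v \<bullet> w"
      unfolding w_def using transpose_vec_mult_scalar[OF A u v] by (simp add: u_def)
    have ww: "w \<bullet> w \<le> t * (u \<bullet> u)" unfolding w_def by (rule Ax[OF u])
    show ?thesis
    proof (cases "w = 0\<^sub>v m")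
      case True
      then have u0: "u \<bullet> u = 0" unfolding uu using v by simp
      show ?thesis
      proof (cases "v = 0\<^sub>v m")
        case True
        then show ?thesis using u0 by (simp add: u_def)
      next
        case False
        define x :: "real vec" where "x = unit_vec n 0"
        have x: "x \<in> carrier_vec n" by (simp add: x_def)
        have "x \<bullet> x = 1" using n by (simp add: x_def)
        then have "0 < x \<bullet> x" by simp
        moreover have "0 \<le> t * (x \<bullet> x)"
          using order_trans[OF scalar_prod_self_nonneg[OF mult_mat_vec_carrier[OF A x]] Ax[OF x]] .
        ultimately have "t \<ge> 0" by (simp add: zero_le_mult_iff)
        then show ?thesis using u0 scalar_prod_self_nonneg[OF v] by (simp add: u_def)
      qed
    next
      case False
      then have "0 < t * (u \<bullet> u)" using scalar_prod_self_pos[OF w] ww by linarith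
      then have tpos: "t > 0" using scalar_prod_self_nonneg[OF u] by (simp add: zero_less_mult_iff)
      have "0 \<le> (t \<cdot>\<^sub>v v - w) \<bullet> (t \<cdot>\<^sub>v v - w)" using v w by (intro scalar_prod_self_nonneg[of _ m]) simp
      also have "\<dots> = t * (t * (v \<bullet> v)) - 2 * t * (v \<bullet> w) + w \<bullet> w"
        using v w comm_scalar_prod[OF w v]
        by (simp add: minus_scalar_prod_distrib[of _ m] scalar_prod_minus_distrib[of _ m] algebra_simps)
      also have "\<dots> \<le> t * (t * (v \<bullet> v)) - t * (u \<bullet> u)" using ww uu by (simp add: algebra_simps)
      finally have "t * (u \<bullet> u) \<le> t * (t * (v \<bullet> v))" by simp
      then show ?thesis using tpos by (simp add: u_def)
    qed
  qed
  then show thesis using that ev by blast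
qed

lemma sigma_max_bounds_transpose:
  assumes A: "A \<in> carrier_mat m n" and v: "v \<in> carrier_vec m"
  shows "(transpose_mat A *\<^sub>v v) \<bullet> (transpose_mat A *\<^sub>v v) \<le> (sigma_max A)\<^sup>2 * (v \<bullet> v)"
proof -
  have vv: "0 \<le> v \<bullet> v" by (rule scalar_prod_self_nonneg[OF v])
  show ?thesis
  proof (cases "n = 0")
    \<comment> \<open>\<^term>\<open>sigma_max A\<close> is unspecified here, but the left-hand side is an empty sum.\<close>
    case True
    then have "transpose_mat A *\<^sub>v v \<in> carrier_vec 0" using A v by auto
    then show ?thesis using vv by (simp add: scalar_prod_self_as_sum)
  next
    case False
    let ?B = "transpose_mat A * A"
    have B: "?B \<in> carrier_mat n n" using A by simp
    obtain t where ev: "eigenvalue ?B t"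
      and t: "(transpose_mat A *\<^sub>v v) \<bullet> (transpose_mat A *\<^sub>v v) \<le> t * (v \<bullet> v)"
      using Gram_eigenvalue_bounds_transpose[OF A] False v by blast
    have "char_poly ?B \<noteq> 0" using degree_monic_char_poly[OF B] False by auto
    then have "finite {l. eigenvalue ?B l}"
      unfolding eigenvalue_root_char_poly[OF B] by (rule poly_roots_finite)
    then have "finite {sqrt l |l. eigenvalue ?B l}" by simp
    then have le: "sqrt t \<le> sigma_max A" unfolding sigma_max_def using ev by (intro Max_ge) auto
    then have "t \<le> (sigma_max A)\<^sup>2" by (rule sqrt_le_D)
    then show ?thesis by (rule order_trans[OF t mult_right_mono[OF _ vv]])
  qed
qed

section \<open>Eigenvalues of a symmetric definite pencil\<close>

lemma positive_definite_det_nonzero: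
  fixes B :: "real mat"
  assumes B: "B \<in> carrier_mat n n"
    and pos: "\<And>x. x \<in> carrier_vec n \<Longrightarrow> x \<noteq> 0\<^sub>v n \<Longrightarrow> x \<bullet> (B *\<^sub>v x) > 0"
  shows "det B \<noteq> 0"
proof
  assume "det B = 0"
  then obtain x where x: "x \<in> carrier_vec n" "x \<noteq> 0\<^sub>v n" "B *\<^sub>v x = 0\<^sub>v n"
    using det_0_iff_vec_prod_zero_field[OF B] by blast
  then show False using pos[OF x(1,2)] by simp
qed

text \<open>The Rayleigh quotient argument for \<open>M w = l P w\<close> with a complex eigenvector \<open>w = x + i y\<close> and
\<open>l = a + i b\<close>, carried out on real and imaginary parts. With
\<open>p = x \<bullet> P x + y \<bullet> P y > 0\<close>, the real part of the conjugate of \<open>w\<close> times \<open>M w\<close> gives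
\<open>x \<bullet> M x + y \<bullet> M y = a p\<close>, and the imaginary part vanishes by symmetry, so \<open>b p = 0\<close>.\<close>

lemma pencil_eigenvalue_real_bounded:
  fixes N P M :: "real mat" and l :: complex
  assumes carr: "N \<in> carrier_mat m m" "P \<in> carrier_mat m m" "M \<in> carrier_mat m m"
    and PN: "P * N = M"
    and symP: "transpose_mat P = P" and symM: "transpose_mat M = M"
    and pos: "\<And>x. x \<in> carrier_vec m \<Longrightarrow> x \<noteq> 0\<^sub>v m \<Longrightarrow> x \<bullet> (P *\<^sub>v x) > 0"
    and lower: "\<And>x. x \<in> carrier_vec m \<Longrightarrow> x \<bullet> (P *\<^sub>v x) \<le> x \<bullet> (M *\<^sub>v x)"
    and upper: "\<And>x. x \<in> carrier_vec m \<Longrightarrow> x \<bullet> (M *\<^sub>v x) \<le> K * (x \<bullet> (P *\<^sub>v x))"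
    and ev: "eigenvalue (map_mat complex_of_real N) l"
  shows "l = complex_of_real (Re l)" "1 \<le> Re l" "Re l \<le> K"
proof -
  obtain w where w: "w \<in> carrier_vec m" "w \<noteq> 0\<^sub>v m" "map_mat complex_of_real N *\<^sub>v w = l \<cdot>\<^sub>v w"
    using ev carr by (auto simp: eigenvalue_def eigenvector_def)
  define x y where "x = map_vec Re w" and "y = map_vec Im w"
  have x: "x \<in> carrier_vec m" and y: "y \<in> carrier_vec m" using w(1) by (auto simp: x_def y_def)
  define a b where "a = Re l" and "b = Im l"
  have comp: "(\<Sum>j<m. complex_of_real (N $$ (i,j)) * w $ j) = l * w $ i" if "i < m" for i
    using arg_cong[OF w(3), of "\<lambda>u. u $ i"] that w(1) carr
    by (simp add: scalar_prod_def atLeast0LessThan)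
  have Nx: "N *\<^sub>v x = a \<cdot>\<^sub>v x - b \<cdot>\<^sub>v y"
  proof (rule eq_vecI)
    fix i assume "i < dim_vec (a \<cdot>\<^sub>v x - b \<cdot>\<^sub>v y)"
    then have i: "i < m" using y by simp
    have "(N *\<^sub>v x) $ i = Re (\<Sum>j<m. complex_of_real (N $$ (i,j)) * w $ j)"
      using i w(1) carr by (simp add: x_def scalar_prod_def atLeast0LessThan)
    then show "(N *\<^sub>v x) $ i = (a \<cdot>\<^sub>v x - b \<cdot>\<^sub>v y) $ i"
      unfolding comp[OF i] using i w(1) by (simp add: x_def y_def a_def b_def)
  qed (use carr y in auto)
  have Ny: "N *\<^sub>v y = b \<cdot>\<^sub>v x + a \<cdot>\<^sub>v y"
  proof (rule eq_vecI)
    fix i assume "i < dim_vec (b \<cdot>\<^sub>v x + a \<cdot>\<^sub>v y)"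
    then have i: "i < m" using y by simp
    have "(N *\<^sub>v y) $ i = Im (\<Sum>j<m. complex_of_real (N $$ (i,j)) * w $ j)"
      using i w(1) carr by (simp add: y_def scalar_prod_def atLeast0LessThan)
    then show "(N *\<^sub>v y) $ i = (b \<cdot>\<^sub>v x + a \<cdot>\<^sub>v y) $ i"
      unfolding comp[OF i] using i w(1) by (simp add: x_def y_def a_def b_def)
  qed (use carr y in auto)
  have Px: "P *\<^sub>v x \<in> carrier_vec m" and Py: "P *\<^sub>v y \<in> carrier_vec m" using carr x y by auto
  have Mx: "M *\<^sub>v x = a \<cdot>\<^sub>v (P *\<^sub>v x) - b \<cdot>\<^sub>v (P *\<^sub>v y)"
    unfolding PN[symmetric] using carr x y
    by (simp add: assoc_mult_mat_vec[of _ m m _ m] Nx mult_minus_distrib_mat_vec[of _ m m] mult_mat_vec[of _ m m])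
  have My: "M *\<^sub>v y = b \<cdot>\<^sub>v (P *\<^sub>v x) + a \<cdot>\<^sub>v (P *\<^sub>v y)"
    unfolding PN[symmetric] using carr x y
    by (simp add: assoc_mult_mat_vec[of _ m m _ m] Ny mult_add_distrib_mat_vec[of _ m m] mult_mat_vec[of _ m m])
  have swap: "y \<bullet> (S *\<^sub>v x) = x \<bullet> (S *\<^sub>v y)" if "S \<in> carrier_mat m m" "transpose_mat S = S" for S
    using transpose_vec_mult_scalar[OF that(1) x y] that comm_scalar_prod[of "S *\<^sub>v y" m x] x y by simp
  have q: "u \<bullet> (M *\<^sub>v x) = a * (u \<bullet> (P *\<^sub>v x)) - b * (u \<bullet> (P *\<^sub>v y))"
    "u \<bullet> (M *\<^sub>v y) = b * (u \<bullet> (P *\<^sub>v x)) + a * (u \<bullet> (P *\<^sub>v y))"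
    if "u \<in> carrier_vec m" for u
    unfolding Mx My using that Px Py
    by (simp_all add: scalar_prod_minus_distrib[of _ m] scalar_prod_add_distrib[of _ m])
  define p where "p = x \<bullet> (P *\<^sub>v x) + y \<bullet> (P *\<^sub>v y)"
  have "p > 0"
  proof -
    have z: "0 \<le> u \<bullet> (P *\<^sub>v u)" if "u \<in> carrier_vec m" for u
      using pos[OF that] that carr by (cases "u = 0\<^sub>v m") auto
    have "x \<noteq> 0\<^sub>v m \<or> y \<noteq> 0\<^sub>v m"
    proof (rule ccontr)
      assume "\<not> ?thesis"
      then have "x $ i = 0" "y $ i = 0" if "i < m" for i using that by auto
      then have "w = 0\<^sub>v m" using w(1)
        by (intro eq_vecI) (auto simp: x_def y_def complex_eq_iff)
      then show False using w(2) by simp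
    qed
    then show ?thesis unfolding p_def
      using pos[OF x] z[OF y] pos[OF y] z[OF x] by linarith
  qed
  have "b * p = y \<bullet> (M *\<^sub>v x) * (-1) + x \<bullet> (M *\<^sub>v y)"
    unfolding p_def using q[OF x] q[OF y] swap[OF carr(2) symP] by (simp add: algebra_simps)
  then have "b * p = 0" using swap[OF carr(3) symM] by simp
  then have "b = 0" using \<open>p > 0\<close> by simp
  then show "l = complex_of_real (Re l)" by (simp add: complex_eq_iff b_def)
  have "a * p = x \<bullet> (M *\<^sub>v x) + y \<bullet> (M *\<^sub>v y)"
    unfolding p_def using q(1)[OF x] q(2)[OF y] \<open>b = 0\<close> by (simp add: algebra_simps)
  then have "p \<le> a * p" "a * p \<le> K * p"
    unfolding p_def using lower[OF x] lower[OF y] upper[OF x] upper[OF y] by (simp_all add: algebra_simps)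
  then show "1 \<le> Re l" "Re l \<le> K" using \<open>p > 0\<close> by (simp_all add: a_def)
qed

section \<open>Regularized weighted Gram matrices\<close>

lemma weighted_Gram_mult_vec:
  fixes A :: "real mat"
  assumes A: "A \<in> carrier_mat m n" and y: "y \<in> carrier_vec m"
  shows "(A * mat_diag n f * transpose_mat A + d \<cdot>\<^sub>m 1\<^sub>m m) *\<^sub>v y
    = A *\<^sub>v (mat_diag n f *\<^sub>v (transpose_mat A *\<^sub>v y)) + d \<cdot>\<^sub>v y"
proof -
  let ?D = "mat_diag n f"
  have D: "?D \<in> carrier_mat n n" by simp
  have At: "transpose_mat A \<in> carrier_mat n m" using A by simp
  then have v: "transpose_mat A *\<^sub>v y \<in> carrier_vec n" using y by (rule mult_mat_vec_carrier)
  have "(A * ?D * transpose_mat A + d \<cdot>\<^sub>m 1\<^sub>m m) *\<^sub>v y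
    = (A * ?D * transpose_mat A) *\<^sub>v y + (d \<cdot>\<^sub>m 1\<^sub>m m) *\<^sub>v y"
    using A D At y by (intro add_mult_distrib_mat_vec[of _ m m]) auto
  moreover have "(d \<cdot>\<^sub>m 1\<^sub>m m) *\<^sub>v y = d \<cdot>\<^sub>v y"
    using y by (intro eq_vecI) auto
  moreover have "(A * ?D * transpose_mat A) *\<^sub>v y = A *\<^sub>v (?D *\<^sub>v (transpose_mat A *\<^sub>v y))"
    using A D At y v by (simp add: assoc_mult_mat_vec[of _ m n _ m] assoc_mult_mat_vec[of _ m n _ n])
  ultimately show ?thesis by (simp only:)
qed

lemma weighted_Gram_scalar_prod:
  fixes A :: "real mat"
  assumes A: "A \<in> carrier_mat m n" and x: "x \<in> carrier_vec m" and y: "y \<in> carrier_vec m"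
  shows "x \<bullet> ((A * mat_diag n f * transpose_mat A + d \<cdot>\<^sub>m 1\<^sub>m m) *\<^sub>v y)
    = (\<Sum>i<n. f i * ((transpose_mat A *\<^sub>v x) $ i * (transpose_mat A *\<^sub>v y) $ i)) + d * (x \<bullet> y)"
proof -
  let ?u = "transpose_mat A *\<^sub>v x" and ?v = "transpose_mat A *\<^sub>v y"
  let ?D = "mat_diag n f"
  have D: "?D \<in> carrier_mat n n" by simp
  have At: "transpose_mat A \<in> carrier_mat n m" using A by simp
  have u: "?u \<in> carrier_vec n" and v: "?v \<in> carrier_vec n" using At x y by auto
  have Dz: "?D *\<^sub>v z = vec n (\<lambda>i. f i * z $ i)" if z: "z \<in> carrier_vec n" for z
  proof (rule eq_vecI)
    fix i assume "i < dim_vec (vec n (\<lambda>i. f i * z $ i))"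
    then have i: "i < n" by simp
    have "(?D *\<^sub>v z) $ i = (\<Sum>j<n. (if i = j then f j else 0) * z $ j)"
      using i z by (simp add: mat_diag_def scalar_prod_def atLeast0LessThan)
    also have "\<dots> = (\<Sum>j<n. if i = j then f j * z $ j else 0)" by (intro sum.cong) auto
    finally show "(?D *\<^sub>v z) $ i = vec n (\<lambda>i. f i * z $ i) $ i" using i by simp
  qed (simp add: mat_diag_def)
  note Dv = Dz[OF v]
  have "x \<bullet> (A *\<^sub>v (?D *\<^sub>v ?v) + d \<cdot>\<^sub>v y) = x \<bullet> (A *\<^sub>v (?D *\<^sub>v ?v)) + d * (x \<bullet> y)"
    using x y mult_mat_vec_carrier[OF A mult_mat_vec_carrier[OF D v]]
    by (subst scalar_prod_add_distrib[of _ m]) simp_all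
  moreover have "x \<bullet> (A *\<^sub>v (?D *\<^sub>v ?v)) = ?u \<bullet> (?D *\<^sub>v ?v)"
    using transpose_vec_mult_scalar[OF A mult_mat_vec_carrier[OF D v] x] by simp
  moreover have "?u \<bullet> (?D *\<^sub>v ?v) = (\<Sum>i<n. f i * (?u $ i * ?v $ i))"
    unfolding Dv using u by (auto simp: scalar_prod_def atLeast0LessThan intro!: sum.cong)
  ultimately show ?thesis unfolding weighted_Gram_mult_vec[OF A y] by (simp only:)
qed

lemma weighted_Gram_symmetric:
  fixes A :: "real mat"
  assumes A: "A \<in> carrier_mat m n"
  shows "transpose_mat (A * mat_diag n f * transpose_mat A + d \<cdot>\<^sub>m 1\<^sub>m m)
    = A * mat_diag n f * transpose_mat A + d \<cdot>\<^sub>m 1\<^sub>m m"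
proof -
  have D: "mat_diag n f \<in> carrier_mat n n" by simp
  have At: "transpose_mat A \<in> carrier_mat n m" using A by simp
  have td: "transpose_mat (mat_diag n f) = mat_diag n f" by (rule eq_matI) (auto simp: mat_diag_def)
  have "transpose_mat (A * mat_diag n f * transpose_mat A) = A * (mat_diag n f * transpose_mat A)"
    using A D At by (simp add: transpose_mult[of _ m n _ m] transpose_mult[of _ m n _ n] td)
  also have "\<dots> = A * mat_diag n f * transpose_mat A" using A D At by (simp add: assoc_mult_mat[of _ m n _ n _ m])
  finally have "transpose_mat (A * mat_diag n f * transpose_mat A) = A * mat_diag n f * transpose_mat A" .
  moreover have "transpose_mat (d \<cdot>\<^sub>m 1\<^sub>m m) = (d \<cdot>\<^sub>m 1\<^sub>m m :: real mat)" by (rule eq_matI) auto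
  moreover have "A * mat_diag n f * transpose_mat A \<in> carrier_mat m m"
    using A D At by (intro mult_carrier_mat)
  ultimately show ?thesis by (subst transpose_add[of _ m m]) simp_all
qed

lemma weighted_Gram_mult_kernel:
  fixes A :: "real mat"
  assumes A: "A \<in> carrier_mat m n" and v: "v \<in> carrier_vec m" "transpose_mat A *\<^sub>v v = 0\<^sub>v n"
  shows "(A * mat_diag n f * transpose_mat A + d \<cdot>\<^sub>m 1\<^sub>m m) *\<^sub>v v = d \<cdot>\<^sub>v v"
proof -
  have "mat_diag n f *\<^sub>v 0\<^sub>v n = 0\<^sub>v n" by (intro eq_vecI) (auto simp: mat_diag_def)
  moreover have "A *\<^sub>v 0\<^sub>v n = 0\<^sub>v m" using A by (intro eq_vecI) auto
  ultimately show ?thesis unfolding weighted_Gram_mult_vec[OF A v(1)] v(2) using v(1) by simp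
qed

text \<open>The dropping rule enters the bounds only through \<open>0 \<le> e \<le> g \<le> e + c\<close>: the forms of \<open>M\<close> and \<open>P\<close> then
differ by at most \<open>c (A\<^sup>T x) \<bullet> (A\<^sup>T x)\<close>, and the form of \<open>P\<close> is at least \<open>d (x \<bullet> x)\<close>.\<close>

lemma preconditioned_weighted_Gram:
  fixes A :: "real mat" and e g :: "nat \<Rightarrow> real"
  assumes A: "A \<in> carrier_mat m n" and d: "d > 0" and c: "c \<ge> 0"
    and eg: "\<And>i. i < n \<Longrightarrow> 0 \<le> e i \<and> e i \<le> g i \<and> g i \<le> e i + c"
    and P: "P = A * mat_diag n e * transpose_mat A + d \<cdot>\<^sub>m 1\<^sub>m m"
    and M: "M = A * mat_diag n g * transpose_mat A + d \<cdot>\<^sub>m 1\<^sub>m m"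
  shows "invertible_mat P"
    and "eigenvalue (map_mat complex_of_real (mat_inv P * M)) l \<Longrightarrow>
      l = complex_of_real (Re l) \<and> 1 \<le> Re l \<and> Re l \<le> 1 + c / d * (sigma_max A)\<^sup>2"
    and "v \<in> mat_kernel (transpose_mat A) \<Longrightarrow> mat_inv P * M *\<^sub>v v = v"
    and "mat_inv P * M \<in> carrier_mat m m"
proof -
  have At: "transpose_mat A \<in> carrier_mat n m" using A by simp
  have carr: "A * mat_diag n f * transpose_mat A \<in> carrier_mat m m" for f
    using A At by (intro mult_carrier_mat[of _ m n] mult_carrier_mat[of _ m n _ n]) auto
  have Pc: "P \<in> carrier_mat m m" and Mc: "M \<in> carrier_mat m m"
    using carr by (auto simp: P M)
  have form: "x \<bullet> ((A * mat_diag n f * transpose_mat A + d \<cdot>\<^sub>m 1\<^sub>m m) *\<^sub>v x)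
      = (\<Sum>i<n. f i * ((transpose_mat A *\<^sub>v x) $ i)\<^sup>2) + d * (x \<bullet> x)"
    if "x \<in> carrier_vec m" for x f
    unfolding weighted_Gram_scalar_prod[OF A that that] by (simp add: power2_eq_square)
  have ge: "d * (x \<bullet> x) \<le> x \<bullet> (P *\<^sub>v x)" if x: "x \<in> carrier_vec m" for x
    unfolding P form[OF x] using eg by (auto intro!: sum_nonneg mult_nonneg_nonneg)
  have pos: "x \<bullet> (P *\<^sub>v x) > 0" if x: "x \<in> carrier_vec m" "x \<noteq> 0\<^sub>v m" for x
    using ge[OF x(1)] mult_pos_pos[OF d scalar_prod_self_pos[OF x]] by linarith
  note inv = det_nonzero_mat_inv[OF Pc positive_definite_det_nonzero[OF Pc pos]]
  show "invertible_mat P" by (rule inv(4))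
  show Nc: "mat_inv P * M \<in> carrier_mat m m" using inv(1) Mc by simp
  have PN: "P * (mat_inv P * M) = M"
    using assoc_mult_mat[OF Pc inv(1) Mc] inv(2) Mc by simp
  have lower: "x \<bullet> (P *\<^sub>v x) \<le> x \<bullet> (M *\<^sub>v x)" if x: "x \<in> carrier_vec m" for x
    unfolding P M form[OF x] using eg by (auto intro!: sum_mono mult_right_mono)
  have upper: "x \<bullet> (M *\<^sub>v x) \<le> (1 + c / d * (sigma_max A)\<^sup>2) * (x \<bullet> (P *\<^sub>v x))"
    if x: "x \<in> carrier_vec m" for x
  proof -
    let ?u = "transpose_mat A *\<^sub>v x"
    have u: "?u \<in> carrier_vec n" using At x by simp
    have "(\<Sum>i<n. g i * (?u $ i)\<^sup>2) \<le> (\<Sum>i<n. (e i + c) * (?u $ i)\<^sup>2)"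
      using eg by (intro sum_mono mult_right_mono) auto
    also have "\<dots> = (\<Sum>i<n. e i * (?u $ i)\<^sup>2) + c * (?u \<bullet> ?u)"
      unfolding scalar_prod_self_as_sum[OF u] by (simp add: sum_distrib_left sum.distrib algebra_simps)
    finally have "x \<bullet> (M *\<^sub>v x) \<le> x \<bullet> (P *\<^sub>v x) + c * (?u \<bullet> ?u)"
      unfolding P M form[OF x] by simp
    also have "c * (?u \<bullet> ?u) \<le> c * ((sigma_max A)\<^sup>2 * (x \<bullet> x))"
      using sigma_max_bounds_transpose[OF A x] c by (rule mult_left_mono)
    also have "\<dots> = c / d * (sigma_max A)\<^sup>2 * (d * (x \<bullet> x))" using d by simp
    also have "\<dots> \<le> c / d * (sigma_max A)\<^sup>2 * (x \<bullet> (P *\<^sub>v x))"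
      using ge[OF x] c d by (intro mult_left_mono) auto
    finally show ?thesis by (simp add: algebra_simps)
  qed
  have sym: "transpose_mat P = P" "transpose_mat M = M"
    unfolding P M by (rule weighted_Gram_symmetric[OF A])+
  show "l = complex_of_real (Re l) \<and> 1 \<le> Re l \<and> Re l \<le> 1 + c / d * (sigma_max A)\<^sup>2"
    if "eigenvalue (map_mat complex_of_real (mat_inv P * M)) l"
    using pencil_eigenvalue_real_bounded[OF Nc Pc Mc PN sym pos lower upper that] by blast
  show "mat_inv P * M *\<^sub>v v = v" if "v \<in> mat_kernel (transpose_mat A)"
  proof -
    have v: "v \<in> carrier_vec m" "transpose_mat A *\<^sub>v v = 0\<^sub>v n" using mat_kernelD[OF At that] by auto
    have "M *\<^sub>v v = P *\<^sub>v v" unfolding P M weighted_Gram_mult_kernel[OF A v] ..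
    then have "mat_inv P * M *\<^sub>v v = mat_inv P * P *\<^sub>v v"
      using assoc_mult_mat_vec[OF inv(1) Mc v(1)] assoc_mult_mat_vec[OF inv(1) Pc v(1)] by simp
    then show ?thesis using inv(3) v(1) by simp
  qed
qed

section \<open>Spectrum of the preconditioned normal equations\<close>

lemma sym_psd_mat_diag_nonneg:
  assumes "sym_psd_mat n Q" "i < n"
  shows "0 \<le> Q $$ (i,i)"
proof -
  have Q: "Q \<in> carrier_mat n n" and "0 \<le> unit_vec n i \<bullet> (Q *\<^sub>v unit_vec n i)"
    using assms(1) by (auto simp: sym_psd_mat_def)
  moreover have "unit_vec n i \<bullet> (Q *\<^sub>v unit_vec n i) = Q $$ (i,i)"
    using Q assms(2) by (simp add: scalar_prod_left_unit[of _ n] scalar_prod_right_unit[of _ n])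
  ultimately show ?thesis by simp
qed

theorem theorem1:
  fixes m n r :: nat and A Q \<Theta> P M :: "real mat" and \<rho> \<delta> \<mu> C :: real
  assumes A: "A \<in> carrier_mat m n"
    and Q: "sym_psd_mat n Q"
    and \<Theta>: "\<Theta> \<in> carrier_mat n n" "diagonal_mat \<Theta>" "\<forall>i<n. \<Theta> $$ (i,i) > 0"
    and pos: "\<rho> > 0" "\<delta> > 0" "\<mu> > 0" "C > 0"
    and r: "r = vec_space.rank n (transpose_mat A)"
    and M: "M = M_NE m n A Q \<Theta> \<rho> \<delta>"
    and P: "P = P_NE m n A Q \<Theta> \<rho> \<delta> \<mu> C"
  shows "invertible_mat P \<and>
    (\<exists>L :: real multiset.
       eigenvalue_mset (mat_inv P * M) = replicate_mset (m - r) 1 + image_mset complex_of_real L \<and>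
       size L = r \<and>
       (\<forall>l \<in># L. 1 \<le> l \<and> l \<le> 1 + C * \<mu> / \<delta> * (sigma_max A)\<^sup>2)) \<and>
    (\<exists>V. V \<subseteq> carrier_vec m \<and> finite V \<and> card V = m - r \<and>
       module.lin_indpt class_ring (module_vec TYPE(real) m) V \<and>
       (\<forall>v \<in> V. eigenvector (mat_inv P * M) v 1 \<and> transpose_mat A *\<^sub>v v = 0\<^sub>v n))"
proof -
  define s where "s i = inverse (\<Theta> $$ (i,i)) + Q $$ (i,i) + \<rho>" for i
  define g where "g i = inverse (s i)" for i
  define e where "e i = (if g i < C * min \<mu> 1 then 0 else g i)" for i
  have s: "s i > 0" if "i < n" for i
    using sym_psd_mat_diag_nonneg[OF Q that] \<Theta>(3) that pos(1)
    by (simp add: s_def add_nonneg_pos add_pos_nonneg)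
  have eg: "0 \<le> e i \<and> e i \<le> g i \<and> g i \<le> e i + C * \<mu>" if "i < n" for i
  proof -
    have "C * min \<mu> 1 \<le> C * \<mu>" using pos(4) by (intro mult_left_mono) auto
    moreover have "g i > 0" using s[OF that] by (simp add: g_def)
    moreover have "0 < C * \<mu>" using pos by simp
    ultimately show ?thesis unfolding e_def by (cases "g i < C * min \<mu> 1") simp_all
  qed
  have "\<Theta> = mat_diag n (\<lambda>i. \<Theta> $$ (i,i))"
    using \<Theta>(1,2) by (intro eq_matI) (auto simp: mat_diag_def diagonal_mat_def)
  then have "mat_inv \<Theta> = mat_diag n (\<lambda>i. inverse (\<Theta> $$ (i,i)))"
    using mat_inv_mat_diag[of n "\<lambda>i. \<Theta> $$ (i,i)"] \<Theta>(3) by fastforce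
  then have "diag_part n Q + mat_inv \<Theta> + \<rho> \<cdot>\<^sub>m 1\<^sub>m n = mat_diag n s"
    by (intro eq_matI) (auto simp: mat_diag_def diag_part_def s_def)
  then have "G_tilde n Q \<Theta> \<rho> = mat_diag n g"
    unfolding G_tilde_def g_def using mat_inv_mat_diag[of n s] s by fastforce
  then have M': "M = A * mat_diag n g * transpose_mat A + \<delta> \<cdot>\<^sub>m 1\<^sub>m m"
    unfolding M M_NE_def by simp
  have "E_mat n Q \<Theta> \<rho> \<mu> C = mat_diag n e"
    by (intro eq_matI) (auto simp: E_mat_def mat_diag_def diag_part_def e_def g_def s_def Let_def)
  then have P': "P = A * mat_diag n e * transpose_mat A + \<delta> \<cdot>\<^sub>m 1\<^sub>m m"
    unfolding P P_NE_def by simp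
  have "C * \<mu> \<ge> 0" using pos by simp
  note pre = preconditioned_weighted_Gram[OF A pos(2) this eg P' M']
  have At: "transpose_mat A \<in> carrier_mat n m" using A by simp
  have rm: "r \<le> m" unfolding r by (rule vec_space.rank_le_nc[OF At])
  obtain V where V: "V \<subseteq> mat_kernel (transpose_mat A)" "finite V" "card V = m - r"
      "module.lin_indpt class_ring (module_vec TYPE(real) m) V"
    using mat_kernel_indpt_set[OF At] unfolding r by blast
  have Vc: "V \<subseteq> carrier_vec m" using V(1) mat_kernel_carrier[OF At] by blast
  have "[:-1, 1:] ^ card V dvd char_poly (mat_inv P * M)"
    by (rule eigenvectors_power_dvd_char_poly[OF pre(4) Vc V(4)]) (use V(1) pre(3) in auto)
  then obtain L where L: "eigenvalue_mset (mat_inv P * M) = replicate_mset (m - r) 1 + image_mset complex_of_real L"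
    "size L = m - (m - r)" "\<And>l. l \<in># L \<Longrightarrow> 1 \<le> l \<and> l \<le> 1 + C * \<mu> / \<delta> * (sigma_max A)\<^sup>2"
    unfolding V(3) using eigenvalue_mset_split[OF pre(4) _ pre(2)] by blast
  have "0\<^sub>v m \<notin> V"
  proof
    interpret W: vec_space "TYPE(real)" m .
    assume "0\<^sub>v m \<in> V"
    then show False using W.vs_zero_lin_dep[OF _ V(4)] Vc by simp
  qed
  then have "eigenvector (mat_inv P * M) v 1 \<and> transpose_mat A *\<^sub>v v = 0\<^sub>v n" if "v \<in> V" for v
    using that V(1) Vc pre(3)[of v] carrier_matD[OF pre(4)] mat_kernelD[OF At, of v]
    by (auto simp: eigenvector_def)
  then show ?thesis using pre(1) L rm V Vc by (intro conjI exI[of _ L] exI[of _ V]) auto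
qed

end
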